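(* Let $d\ge1$ and $\boldsymbol\rho\in B_d$. If at least two components of $\boldsymbol\rho$ are positive, then the diagonal operator $D_{\boldsymbol\rho}$ on $\ell^2(\mathbb N_0)$ is compact, and the operator $\mathcal H_{\boldsymbol\rho}$ on $\ell^2(\mathbb N_0^d)$ is compact.
   Context: $B_d=\{\boldsymbol\rho=(\rho_1,\dots,\rho_d)\in[0,1]^d:\rho_1+\cdots+\rho_d\le1\}$ and $R_{\boldsymbol\rho}=\rho_1+\cdots+\rho_d$. For $\alpha\in\mathbb N_0^d$, $|\alpha|=\sum_j\alpha_j$, $\alpha!=\prod_j\alpha_j!$; $0^0=1$. The operator $\mathcal H_{\boldsymbol\rho}$ is the bounded operator on $\ell^2(\mathbb N_0^d)$ with matrix entries \[ (\mathcal H_{\boldsymbol\rho})_{\alpha,\beta}=(-1)^{|\alpha|+|\beta|}\frac{(|\alpha|+|\beta|)!}{\alpha!\,\beta!}\prod_{j=1}^d\left(\frac{\rho_j}{2}\right)^{\alpha_j+\beta_j}. \] For $N\in\mathbb N_0$, $h_N(\boldsymbol\rho)\ge0$ is defined by $h_N(\boldsymbol\rho)^2=\sum_{|\alpha|=N}\frac1{(\alpha!)^2}\prod_{j=1}^d(\rho_j/2)^{2\alpha_j}$; for $\boldsymbol\rho\neq\boldsymbol 0$, $c_N(\boldsymbol\rho)=\dfrac{h_N(\boldsymbol\rho)}{(R_{\boldsymbol\rho}/2)^N/N!}$, and $D_{\boldsymbol\rho}e_N=c_N(\boldsymbol\rho)e_N$ for the standard basis $(e_N)_{N\ge0}$ of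 $\ell^2(\mathbb N_0)$. *)

theory Defs
  imports "HOL-Analysis.Analysis"
begin

typedef 'i ell2 = "{x :: 'i \<Rightarrow> complex. (\<lambda>i. (cmod (x i))\<^sup>2) summable_on UNIV}"
  morphisms ell2_nth Abs_ell2
  by (rule exI[of _ "\<lambda>_. 0"]) simp

setup_lifting type_definition_ell2

lemma ell2_eqI: "(\<And>i. ell2_nth x i = ell2_nth y i) \<Longrightarrow> x = y"
  by (metis ell2_nth_inject ext)

lemma L2_set_le_iff: "0 \<le> B \<Longrightarrow> L2_set f F \<le> B \<longleftrightarrow> (\<Sum>i\<in>F. (f i)\<^sup>2) \<le> B\<^sup>2"
  unfolding L2_set_def by (metis real_sqrt_le_iff real_sqrt_unique)

lemma square_summable_bound:
  assumes "\<And>F. finite F \<Longrightarrow> L2_set (\<lambda>i. cmod (x i)) F \<le> B" "0 \<le> B"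
  shows "(\<lambda>i. (cmod (x i))\<^sup>2) summable_on UNIV"
    and "sqrt (\<Sum>\<^sub>\<infinity>i. (cmod (x i))\<^sup>2) \<le> B"
proof -
  have *: "(\<Sum>i\<in>F. (cmod (x i))\<^sup>2) \<le> B\<^sup>2" if "finite F" for F
    by (rule iffD1[OF L2_set_le_iff[OF assms(2)] assms(1)[OF that]])
  show s: "(\<lambda>i. (cmod (x i))\<^sup>2) summable_on UNIV"
    by (rule nonneg_bounded_partial_sums_imp_summable_on[where C = "B\<^sup>2"])
       (auto intro!: eventually_finite_subsets_at_top_weakI *)
  have "(\<Sum>\<^sub>\<infinity>i. (cmod (x i))\<^sup>2) \<le> B\<^sup>2"
    by (rule infsum_le_finite_sums[OF s]) (use * in auto)
  thus "sqrt (\<Sum>\<^sub>\<infinity>i. (cmod (x i))\<^sup>2) \<le> B"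
    using assms(2) by (simp add: real_le_lsqrt infsum_nonneg)
qed

lemma L2_set_le_infsum:
  assumes "(\<lambda>i. (cmod (x i))\<^sup>2) summable_on UNIV" "finite F"
  shows "L2_set (\<lambda>i. cmod (x i)) F \<le> sqrt (\<Sum>\<^sub>\<infinity>i. (cmod (x i))\<^sup>2)"
  unfolding L2_set_def by (simp add: assms finite_sum_le_infsum)

lemma L2_set_add_le:
  "L2_set (\<lambda>i. cmod (x i + y i)) F \<le> L2_set (\<lambda>i. cmod (x i)) F + L2_set (\<lambda>i. cmod (y i)) F"
  by (rule order_trans[OF L2_set_mono L2_set_triangle_ineq]) (auto simp: norm_triangle_ineq)

lemma L2_set_cmult: "L2_set (\<lambda>i. cmod (c * x i)) F = cmod c * L2_set (\<lambda>i. cmod (x i)) F"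
  by (simp add: norm_mult L2_set_right_distrib)

lemma square_summable_add:
  assumes "(\<lambda>i. (cmod (x i))\<^sup>2) summable_on UNIV" "(\<lambda>i. (cmod (y i))\<^sup>2) summable_on UNIV"
  shows "(\<lambda>i. (cmod (x i + y i))\<^sup>2) summable_on UNIV"
    and "sqrt (\<Sum>\<^sub>\<infinity>i. (cmod (x i + y i))\<^sup>2)
           \<le> sqrt (\<Sum>\<^sub>\<infinity>i. (cmod (x i))\<^sup>2) + sqrt (\<Sum>\<^sub>\<infinity>i. (cmod (y i))\<^sup>2)"
proof -
  have "L2_set (\<lambda>i. cmod (x i + y i)) F
          \<le> sqrt (\<Sum>\<^sub>\<infinity>i. (cmod (x i))\<^sup>2) + sqrt (\<Sum>\<^sub>\<infinity>i. (cmod (y i))\<^sup>2)" if "finite F" for F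
    using L2_set_add_le[of x y F] L2_set_le_infsum[OF assms(1) that]
      L2_set_le_infsum[OF assms(2) that] by linarith
  from square_summable_bound[OF this]
  show "(\<lambda>i. (cmod (x i + y i))\<^sup>2) summable_on UNIV"
    "sqrt (\<Sum>\<^sub>\<infinity>i. (cmod (x i + y i))\<^sup>2)
       \<le> sqrt (\<Sum>\<^sub>\<infinity>i. (cmod (x i))\<^sup>2) + sqrt (\<Sum>\<^sub>\<infinity>i. (cmod (y i))\<^sup>2)"
    by (simp_all add: infsum_nonneg)
qed

lemma square_summable_cmult:
  "(\<lambda>i. (cmod (x i))\<^sup>2) summable_on UNIV \<Longrightarrow> (\<lambda>i. (cmod (c * x i))\<^sup>2) summable_on UNIV"
  by (simp add: norm_mult power_mult_distrib summable_on_cmult_right)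

lift_definition scaleC_ell2 :: "complex \<Rightarrow> 'i ell2 \<Rightarrow> 'i ell2" (infixr \<open>*\<^sub>C\<close> 75)
  is "\<lambda>c x i. c * x i"
  by (simp add: square_summable_cmult)

instantiation ell2 :: (type) real_vector
begin

lift_definition zero_ell2 :: "'a ell2" is "\<lambda>_. 0" by simp
lift_definition plus_ell2 :: "'a ell2 \<Rightarrow> 'a ell2 \<Rightarrow> 'a ell2" is "\<lambda>x y i. x i + y i"
  by (simp add: square_summable_add)
lift_definition uminus_ell2 :: "'a ell2 \<Rightarrow> 'a ell2" is "\<lambda>x i. - x i" by simp
lift_definition minus_ell2 :: "'a ell2 \<Rightarrow> 'a ell2 \<Rightarrow> 'a ell2" is "\<lambda>x y i. x i - y i"
  using square_summable_add(1)[of _ "\<lambda>i. - _ i"] by simp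
lift_definition scaleR_ell2 :: "real \<Rightarrow> 'a ell2 \<Rightarrow> 'a ell2" is "\<lambda>r x i. complex_of_real r * x i"
  by (simp add: square_summable_cmult)

instance
  by standard (transfer; simp add: algebra_simps fun_eq_iff)+

end

instantiation ell2 :: (type) real_normed_vector
begin

lift_definition norm_ell2 :: "'a ell2 \<Rightarrow> real" is "\<lambda>x. sqrt (\<Sum>\<^sub>\<infinity>i. (cmod (x i))\<^sup>2)" .

definition dist_ell2 :: "'a ell2 \<Rightarrow> 'a ell2 \<Rightarrow> real" where
  "dist_ell2 x y = norm (x - y)"
definition sgn_ell2 :: "'a ell2 \<Rightarrow> 'a ell2" where
  "sgn_ell2 x = x /\<^sub>R norm x"
definition uniformity_ell2 :: "('a ell2 \<times> 'a ell2) filter" where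
  "uniformity_ell2 = (INF e\<in>{0<..}. principal {(x, y). dist x y < e})"
definition open_ell2 :: "'a ell2 set \<Rightarrow> bool" where
  "open_ell2 U \<longleftrightarrow> (\<forall>x\<in>U. \<forall>\<^sub>F (x', y) in uniformity. x' = x \<longrightarrow> y \<in> U)"

instance
proof
  fix x y :: "'a ell2" and r :: real
  show "norm x = 0 \<longleftrightarrow> x = 0"
  proof (transfer, safe)
    fix x :: "'a \<Rightarrow> complex"
    assume s: "(\<lambda>i. (cmod (x i))\<^sup>2) summable_on UNIV"
      and z: "sqrt (\<Sum>\<^sub>\<infinity>i. (cmod (x i))\<^sup>2) = 0"
    have "(cmod (x i))\<^sup>2 = 0" for i
      by (rule nonneg_infsum_le_0D[of _ UNIV]) (use s z in auto)
    thus "x = (\<lambda>_. 0)" by auto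
  qed simp
  show "norm (x + y) \<le> norm x + norm y"
    by transfer (rule square_summable_add; simp)
  show "norm (r *\<^sub>R x) = \<bar>r\<bar> * norm x"
    by transfer (simp only: norm_mult norm_of_real power_mult_distrib infsum_cmult_right'
        real_sqrt_mult real_sqrt_abs abs_abs)
qed (rule dist_ell2_def sgn_ell2_def uniformity_ell2_def open_ell2_def)+

end

lemma norm_ell2_sq: "(norm x)\<^sup>2 = (\<Sum>\<^sub>\<infinity>i. (cmod (ell2_nth x i))\<^sup>2)"
  by transfer (simp add: infsum_nonneg)

lemma square_summable_ell2: "(\<lambda>i. (cmod (ell2_nth x i))\<^sup>2) summable_on UNIV"
  by transfer simp

lemma L2_set_le_norm: "finite F \<Longrightarrow> L2_set (\<lambda>i. cmod (ell2_nth x i)) F \<le> norm x"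
  by transfer (rule L2_set_le_infsum; simp)

lemma norm_le_of_L2_set:
  "(\<And>F. finite F \<Longrightarrow> L2_set (\<lambda>i. cmod (ell2_nth x i)) F \<le> B) \<Longrightarrow> 0 \<le> B \<Longrightarrow> norm x \<le> B"
  by transfer (rule square_summable_bound; simp)

lemma norm_ell2_nth_le: "cmod (ell2_nth x i) \<le> norm x"
  using L2_set_le_norm[of "{i}" x] by simp

instance ell2 :: (type) banach
proof
  fix X :: "nat \<Rightarrow> 'a ell2"
  assume X: "Cauchy X"
  have "Cauchy (\<lambda>n. ell2_nth (X n) i)" for i
  proof (rule metric_CauchyI)
    fix e :: real assume "e > 0"
    then obtain M where M: "dist (X m) (X n) < e" if "m \<ge> M" "n \<ge> M" for m n
      using metric_CauchyD[OF X] by blast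
    have "dist (ell2_nth (X m) i) (ell2_nth (X n) i) \<le> dist (X m) (X n)" for m n
      using norm_ell2_nth_le[of "X m - X n" i] by (simp add: dist_norm minus_ell2.rep_eq)
    thus "\<exists>M. \<forall>m\<ge>M. \<forall>n\<ge>M. dist (ell2_nth (X m) i) (ell2_nth (X n) i) < e"
      using M by (meson le_less_trans)
  qed
  hence "\<forall>i. \<exists>a. (\<lambda>n. ell2_nth (X n) i) \<longlonglongrightarrow> a"
    by (simp add: Cauchy_convergent_iff convergent_def)
  then obtain l where l: "\<And>i. (\<lambda>n. ell2_nth (X n) i) \<longlonglongrightarrow> l i"
    by (auto simp: choice_iff)
  have tail: "L2_set (\<lambda>i. cmod (ell2_nth (X m) i - l i)) F \<le> e"
    if e: "\<And>n. n \<ge> m \<Longrightarrow> dist (X m) (X n) \<le> e" and F: "finite F" for m e F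
  proof (rule LIMSEQ_le_const2)
    show "(\<lambda>n. L2_set (\<lambda>i. cmod (ell2_nth (X m) i - ell2_nth (X n) i)) F)
            \<longlonglongrightarrow> L2_set (\<lambda>i. cmod (ell2_nth (X m) i - l i)) F"
      unfolding L2_set_def by (intro tendsto_intros l)
    have "L2_set (\<lambda>i. cmod (ell2_nth (X m) i - ell2_nth (X n) i)) F \<le> e" if "n \<ge> m" for n
      using L2_set_le_norm[OF F, of "X m - X n"] e[OF that]
      by (simp add: dist_norm minus_ell2.rep_eq)
    thus "\<exists>N. \<forall>n\<ge>N. L2_set (\<lambda>i. cmod (ell2_nth (X m) i - ell2_nth (X n) i)) F \<le> e"
      by blast
  qed
  obtain m1 where m1: "\<And>m n. m \<ge> m1 \<Longrightarrow> n \<ge> m1 \<Longrightarrow> dist (X m) (X n) < 1"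
    using metric_CauchyD[OF X, of 1] by auto
  have "L2_set (\<lambda>i. cmod (l i)) F \<le> norm (X m1) + 1" if F: "finite F" for F
  proof -
    have "L2_set (\<lambda>i. cmod (ell2_nth (X m1) i - l i)) F \<le> 1"
      by (rule tail[OF _ F]) (use m1 in \<open>auto intro: less_imp_le\<close>)
    moreover have "L2_set (\<lambda>i. cmod (l i)) F
        \<le> L2_set (\<lambda>i. cmod (ell2_nth (X m1) i)) F + L2_set (\<lambda>i. cmod (ell2_nth (X m1) i - l i)) F"
      using L2_set_add_le[of "ell2_nth (X m1)" "\<lambda>i. l i - ell2_nth (X m1) i" F]
      by (simp add: norm_minus_commute)
    ultimately show ?thesis using L2_set_le_norm[OF F, of "X m1"] by linarith
  qed
  hence "(\<lambda>i. (cmod (l i))\<^sup>2) summable_on UNIV"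
    by (rule square_summable_bound) auto
  hence L: "ell2_nth (Abs_ell2 l) = l" by (simp add: Abs_ell2_inverse)
  have "X \<longlonglongrightarrow> Abs_ell2 l"
  proof (rule metric_LIMSEQ_I)
    fix e :: real assume e: "e > 0"
    then obtain M where M: "\<And>m n. m \<ge> M \<Longrightarrow> n \<ge> M \<Longrightarrow> dist (X m) (X n) < e / 2"
      using metric_CauchyD[OF X, of "e/2"] by auto
    have "dist (X m) (Abs_ell2 l) \<le> e / 2" if "m \<ge> M" for m
      unfolding dist_norm
    proof (rule norm_le_of_L2_set)
      fix F :: "'a set" assume F: "finite F"
      show "L2_set (\<lambda>i. cmod (ell2_nth (X m - Abs_ell2 l) i)) F \<le> e / 2"
        unfolding minus_ell2.rep_eq L
        by (rule tail[OF _ F]) (use M that in \<open>auto intro: less_imp_le\<close>)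
    qed (use e in auto)
    thus "\<exists>M. \<forall>m\<ge>M. dist (X m) (Abs_ell2 l) < e" using e by (intro exI[of _ M]) force
  qed
  thus "convergent X" by (auto simp: convergent_def)
qed

lift_definition ell2_basis :: "'i \<Rightarrow> 'i ell2" is "\<lambda>j i. if i = j then 1 else 0"
  by (rule finite_nonzero_values_imp_summable_on) (rule finite_subset[of _ "{_}"]; auto)

definition bounded_operator :: "('i ell2 \<Rightarrow> 'j ell2) \<Rightarrow> bool" where
  "bounded_operator T \<longleftrightarrow> bounded_linear T \<and> (\<forall>c x. T (c *\<^sub>C x) = c *\<^sub>C T x)"

definition compact_operator :: "('i ell2 \<Rightarrow> 'j ell2) \<Rightarrow> bool" where
  "compact_operator T \<longleftrightarrow> bounded_operator T \<and> compact (closure (T ` cball 0 1))"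

lemma ell2_nth_sum: "ell2_nth (\<Sum>j\<in>F. f j) i = (\<Sum>j\<in>F. ell2_nth (f j) i)"
  by (induction F rule: infinite_finite_induct) (auto simp: zero_ell2.rep_eq plus_ell2.rep_eq)

lemma ell2_finite_section:
  "finite F \<Longrightarrow> ell2_nth (\<Sum>j\<in>F. ell2_nth x j *\<^sub>C ell2_basis j) i = (if i \<in> F then ell2_nth x i else 0)"
  by (simp add: ell2_nth_sum scaleC_ell2.rep_eq ell2_basis.rep_eq if_distrib cong: if_cong)

lemma ell2_approx:
  assumes "e > 0"
  obtains F where "finite F" "norm (x - (\<Sum>j\<in>F. ell2_nth x j *\<^sub>C ell2_basis j)) \<le> e"
proof -
  let ?f = "\<lambda>i. (cmod (ell2_nth x i))\<^sup>2"
  obtain F where F: "finite F" "dist (sum ?f F) (infsum ?f UNIV) \<le> e\<^sup>2"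
    using infsum_finite_approximation[OF square_summable_ell2[of x], of "e\<^sup>2"] assms by auto
  have "norm (x - (\<Sum>j\<in>F. ell2_nth x j *\<^sub>C ell2_basis j)) \<le> e"
  proof (rule norm_le_of_L2_set)
    fix G :: "'a set" assume G: "finite G"
    have "(\<Sum>i\<in>G. (cmod (ell2_nth (x - (\<Sum>j\<in>F. ell2_nth x j *\<^sub>C ell2_basis j)) i))\<^sup>2)
        = (\<Sum>i\<in>G. if i \<in> F then 0 else ?f i)"
      by (rule sum.cong) (auto simp: minus_ell2.rep_eq ell2_finite_section F)
    also have "\<dots> = sum ?f (G - F)"
      by (rule sum.mono_neutral_cong_right) (use G in auto)
    also have "\<dots> = sum ?f ((G - F) \<union> F) - sum ?f F"
      using G F by (subst sum.union_disjoint) auto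
    also have "\<dots> \<le> infsum ?f UNIV - sum ?f F"
      using finite_sum_le_infsum[OF square_summable_ell2[of x], of "(G - F) \<union> F"] G F by auto
    also have "\<dots> \<le> e\<^sup>2" using F(2) by (auto simp: dist_real_def)
    finally show "L2_set (\<lambda>i. cmod (ell2_nth (x - (\<Sum>j\<in>F. ell2_nth x j *\<^sub>C ell2_basis j)) i)) G \<le> e"
      by (subst L2_set_le_iff) (use assms in simp_all)
  qed (use assms in auto)
  thus ?thesis using F that by blast
qed

lemma bounded_operator_eqI:
  assumes T: "bounded_operator T" and S: "bounded_operator S"
    and eq: "\<And>j. T (ell2_basis j) = S (ell2_basis j)"
  shows "T = S"
proof
  fix x
  interpret T: bounded_linear T using T by (simp add: bounded_operator_def)
  interpret S: bounded_linear S using S by (simp add: bounded_operator_def)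
  interpret D: bounded_linear "\<lambda>x. T x - S x"
    by (intro bounded_linear_sub T.bounded_linear_axioms S.bounded_linear_axioms)
  obtain K where K: "K > 0" "\<And>x. norm (T x - S x) \<le> norm x * K" using D.pos_bounded by blast
  have "norm (T x - S x) \<le> e" if e: "e > 0" for e
  proof -
    obtain F where F: "finite F" "norm (x - (\<Sum>j\<in>F. ell2_nth x j *\<^sub>C ell2_basis j)) \<le> e / K"
      by (rule ell2_approx[of "e / K" x]) (use e K in auto)
    let ?y = "\<Sum>j\<in>F. ell2_nth x j *\<^sub>C ell2_basis j"
    have "T ?y = S ?y"
      using T S eq by (simp add: T.sum S.sum bounded_operator_def)
    hence "T x - S x = T (x - ?y) - S (x - ?y)" by (simp add: T.diff S.diff)
    also have "norm \<dots> \<le> norm (x - ?y) * K" using K by blast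
    also have "\<dots> \<le> e / K * K" using F K by (intro mult_right_mono) auto
    finally show ?thesis using K by simp
  qed
  hence "norm (T x - S x) \<le> 0" by (rule field_le_epsilon[of _ 0, simplified])
  thus "T x = S x" by simp
qed

lemma schur_test:
  fixes A :: "'i \<Rightarrow> 'j \<Rightarrow> complex"
  assumes row: "\<And>i G. finite G \<Longrightarrow> (\<Sum>j\<in>G. cmod (A i j)) \<le> C"
    and col: "\<And>j F. finite F \<Longrightarrow> (\<Sum>i\<in>F. cmod (A i j)) \<le> C"
  obtains T :: "'j ell2 \<Rightarrow> 'i ell2"
  where "bounded_operator T" "\<And>i j. ell2_nth (T (ell2_basis j)) i = A i j"
proof -
  have C: "C \<ge> 0" using row[of "{}"] by simp
  have summ: "(\<lambda>j. A i j * ell2_nth x j) summable_on UNIV" for i x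
  proof (rule abs_summable_summable, rule nonneg_bounded_partial_sums_imp_summable_on[where C = "C * norm x"])
    have "(\<Sum>j\<in>G. cmod (A i j * ell2_nth x j)) \<le> C * norm x" if "finite G" for G
    proof -
      have "(\<Sum>j\<in>G. cmod (A i j * ell2_nth x j)) \<le> (\<Sum>j\<in>G. cmod (A i j) * norm x)"
        by (intro sum_mono) (simp add: norm_mult mult_left_mono norm_ell2_nth_le)
      also have "\<dots> \<le> C * norm x"
        using row[OF that] by (simp flip: sum_distrib_right add: mult_right_mono)
      finally show ?thesis .
    qed
    thus "\<forall>\<^sub>F G in finite_subsets_at_top UNIV. (\<Sum>j\<in>G. cmod (A i j * ell2_nth x j)) \<le> C * norm x"
      by (intro eventually_finite_subsets_at_top_weakI)
  qed auto
  define t where "t x i = (\<Sum>\<^sub>\<infinity>j. A i j * ell2_nth x j)" for x i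
  have bound: "L2_set (\<lambda>i. cmod (t x i)) F \<le> C * norm x" if F: "finite F" for x F
  proof (rule LIMSEQ_le_const2[where X = "\<lambda>_. L2_set (\<lambda>i. cmod (t x i)) F"], simp)
    have lim: "((\<lambda>G. L2_set (\<lambda>i. cmod (\<Sum>j\<in>G. A i j * ell2_nth x j)) F)
        \<longlongrightarrow> L2_set (\<lambda>i. cmod (t x i)) F) (finite_subsets_at_top UNIV)"
      unfolding L2_set_def t_def by (intro tendsto_intros infsum_tendsto summ)
    have fin: "L2_set (\<lambda>i. cmod (\<Sum>j\<in>G. A i j * ell2_nth x j)) F \<le> C * norm x" if G: "finite G" for G
    proof -
      let ?a = "\<lambda>i j. cmod (A i j)" and ?x = "\<lambda>j. cmod (ell2_nth x j)"
      have "(cmod (\<Sum>j\<in>G. A i j * ell2_nth x j))\<^sup>2 \<le> C * (\<Sum>j\<in>G. ?a i j * (?x j)\<^sup>2)" for i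
      proof -
        have "cmod (\<Sum>j\<in>G. A i j * ell2_nth x j) \<le> (\<Sum>j\<in>G. \<bar>sqrt (?a i j)\<bar> * \<bar>sqrt (?a i j) * ?x j\<bar>)"
          by (rule order_trans[OF norm_sum]) (simp add: norm_mult abs_mult flip: mult.assoc)
        also have "\<dots> \<le> L2_set (\<lambda>j. sqrt (?a i j)) G * L2_set (\<lambda>j. sqrt (?a i j) * ?x j) G"
          by (rule L2_set_mult_ineq)
        finally have "(cmod (\<Sum>j\<in>G. A i j * ell2_nth x j))\<^sup>2
            \<le> (L2_set (\<lambda>j. sqrt (?a i j)) G * L2_set (\<lambda>j. sqrt (?a i j) * ?x j) G)\<^sup>2"
          by (intro power_mono) auto
        also have "\<dots> = (\<Sum>j\<in>G. ?a i j) * (\<Sum>j\<in>G. ?a i j * (?x j)\<^sup>2)"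
          by (simp add: L2_set_def power_mult_distrib sum_nonneg)
        also have "\<dots> \<le> C * (\<Sum>j\<in>G. ?a i j * (?x j)\<^sup>2)"
          by (intro mult_right_mono row[OF G] sum_nonneg) auto
        finally show ?thesis .
      qed
      hence "(\<Sum>i\<in>F. (cmod (\<Sum>j\<in>G. A i j * ell2_nth x j))\<^sup>2)
          \<le> (\<Sum>i\<in>F. C * (\<Sum>j\<in>G. ?a i j * (?x j)\<^sup>2))" by (rule sum_mono)
      also have "\<dots> = C * (\<Sum>j\<in>G. (\<Sum>i\<in>F. ?a i j) * (?x j)\<^sup>2)"
        unfolding sum_distrib_left[symmetric] sum_distrib_right by (subst sum.swap) (rule refl)
      also have "\<dots> \<le> C * (\<Sum>j\<in>G. C * (?x j)\<^sup>2)"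
        by (intro mult_left_mono sum_mono mult_right_mono col[OF F] C) auto
      also have "\<dots> = C\<^sup>2 * (\<Sum>j\<in>G. (?x j)\<^sup>2)"
        by (simp add: sum_distrib_left[symmetric] power2_eq_square)
      also have "\<dots> \<le> C\<^sup>2 * (norm x)\<^sup>2"
        unfolding norm_ell2_sq
        by (intro mult_left_mono finite_sum_le_infsum square_summable_ell2 G) auto
      finally show ?thesis using C by (subst L2_set_le_iff) (auto simp: power_mult_distrib)
    qed
    show "\<exists>N::nat. \<forall>n\<ge>N. L2_set (\<lambda>i. cmod (t x i)) F \<le> C * norm x"
      using tendsto_upperbound[OF lim eventually_finite_subsets_at_top_weakI[OF fin]] by simp
  qed
  define T where "T x = Abs_ell2 (t x)" for x
  have nth: "ell2_nth (T x) i = t x i" for x i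
  proof -
    have "(\<lambda>i. (cmod (t x i))\<^sup>2) summable_on UNIV"
      by (rule square_summable_bound[where B = "C * norm x"]) (use bound C in auto)
    thus ?thesis by (simp add: T_def Abs_ell2_inverse)
  qed
  have "bounded_linear T"
  proof (rule bounded_linear_intro)
    show "T (x + y) = T x + T y" for x y
      by (rule ell2_eqI) (simp add: nth plus_ell2.rep_eq t_def distrib_left infsum_add summ)
    show "T (r *\<^sub>R x) = r *\<^sub>R T x" for r x
      by (rule ell2_eqI)
         (simp add: nth scaleR_ell2.rep_eq t_def mult.left_commute infsum_cmult_right')
    show "norm (T x) \<le> norm x * C" for x
      by (rule norm_le_of_L2_set) (use bound C in \<open>auto simp: nth mult.commute\<close>)
  qed
  moreover have "T (c *\<^sub>C x) = c *\<^sub>C T x" for c x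
    by (rule ell2_eqI)
       (simp add: nth scaleC_ell2.rep_eq t_def mult.left_commute infsum_cmult_right')
  ultimately have "bounded_operator T" by (simp add: bounded_operator_def)
  moreover have "ell2_nth (T (ell2_basis j)) i = A i j" for i j
  proof -
    have "t (ell2_basis j) i = (\<Sum>\<^sub>\<infinity>k\<in>{j}. A i k)"
      unfolding t_def by (rule infsum_cong_neutral) (auto simp: ell2_basis.rep_eq)
    thus ?thesis by (simp add: nth)
  qed
  ultimately show ?thesis by (rule that)
qed

text \<open>Multi-indices are elements of \<^typ>\<open>nat ^ 'd\<close>, where the nonempty finite type
  \<^typ>\<open>'d\<close> has \<open>d\<close> elements.\<close>

definition B_simplex :: "(real ^ 'd) set" where
  "B_simplex = {\<rho>. (\<forall>j. 0 \<le> \<rho> $ j \<and> \<rho> $ j \<le> 1) \<and> (\<Sum>j\<in>UNIV. \<rho> $ j) \<le> 1}"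

definition R_sum :: "real ^ 'd \<Rightarrow> real" where
  "R_sum \<rho> = (\<Sum>j\<in>UNIV. \<rho> $ j)"

definition mabs :: "nat ^ 'd \<Rightarrow> nat" where
  "mabs \<alpha> = (\<Sum>j\<in>UNIV. \<alpha> $ j)"

definition mfact :: "nat ^ 'd \<Rightarrow> real" where
  "mfact \<alpha> = (\<Prod>j\<in>UNIV. fact (\<alpha> $ j))"

definition H_entry :: "real ^ 'd \<Rightarrow> nat ^ 'd \<Rightarrow> nat ^ 'd \<Rightarrow> real" where
  "H_entry \<rho> \<alpha> \<beta> = (-1) ^ (mabs \<alpha> + mabs \<beta>) * (fact (mabs \<alpha> + mabs \<beta>) / (mfact \<alpha> * mfact \<beta>))
     * (\<Prod>j\<in>UNIV. (\<rho> $ j / 2) ^ (\<alpha> $ j + \<beta> $ j))"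

text \<open>The definite descriptions in \<open>H_op\<close> and \<open>D_op\<close> are justified for every
  \<open>\<rho> \<in> B_simplex\<close> by \<open>H_op_ex1\<close> and \<open>D_op_ex1\<close> below.\<close>

definition H_op :: "real ^ 'd \<Rightarrow> (nat ^ 'd) ell2 \<Rightarrow> (nat ^ 'd) ell2" where
  "H_op \<rho> = (THE T. bounded_operator T \<and>
     (\<forall>\<alpha> \<beta>. ell2_nth (T (ell2_basis \<beta>)) \<alpha> = complex_of_real (H_entry \<rho> \<alpha> \<beta>)))"

definition h_coef :: "nat \<Rightarrow> real ^ 'd \<Rightarrow> real" where
  "h_coef N \<rho> = sqrt (\<Sum>\<alpha> | mabs \<alpha> = N. 1 / (mfact \<alpha>)\<^sup>2 * (\<Prod>j\<in>UNIV. (\<rho> $ j / 2) ^ (2 * \<alpha> $ j)))"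

definition c_coef :: "nat \<Rightarrow> real ^ 'd \<Rightarrow> real" where
  "c_coef N \<rho> = h_coef N \<rho> / ((R_sum \<rho> / 2) ^ N / fact N)"

definition D_op :: "real ^ 'd \<Rightarrow> nat ell2 \<Rightarrow> nat ell2" where
  "D_op \<rho> = (THE T. bounded_operator T \<and>
     (\<forall>N. T (ell2_basis N) = complex_of_real (c_coef N \<rho>) *\<^sub>C ell2_basis N))"

lemma finite_mabs: "finite {\<alpha> :: nat ^ 'd. mabs \<alpha> = N}"
proof (rule finite_subset)
  show "{\<alpha> :: nat ^ 'd. mabs \<alpha> = N} \<subseteq> vec_lambda ` (UNIV \<rightarrow>\<^sub>E {..N})"
  proof
    fix \<alpha> :: "nat ^ 'd" assume "\<alpha> \<in> {\<alpha>. mabs \<alpha> = N}"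
    hence "\<alpha> $ j \<le> N" for j using member_le_sum[of j UNIV "($) \<alpha>"] by (auto simp: mabs_def)
    thus "\<alpha> \<in> vec_lambda ` (UNIV \<rightarrow>\<^sub>E {..N})"
      by (intro image_eqI[of _ _ "($) \<alpha>"]) auto
  qed
qed (intro finite_imageI finite_PiE; simp)

definition mweight :: "real ^ 'd \<Rightarrow> nat ^ 'd \<Rightarrow> real" where
  "mweight \<rho> \<alpha> = (\<Prod>j\<in>UNIV. (\<rho> $ j / 2) ^ (\<alpha> $ j)) / mfact \<alpha>"

lemma mweight_alt: "mweight \<rho> \<alpha> = (\<Prod>j\<in>UNIV. (\<rho> $ j / 2) ^ (\<alpha> $ j) / fact (\<alpha> $ j))"
  by (simp add: mweight_def mfact_def prod_dividef)

lemma mweight_nonneg: "\<rho> \<in> B_simplex \<Longrightarrow> 0 \<le> mweight \<rho> \<alpha>"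
  unfolding mweight_alt by (intro prod_nonneg) (auto simp: B_simplex_def)

lemma mweight_incr:
  fixes \<rho> :: "real ^ 'd"
  shows "real (Suc (\<alpha> $ j)) * mweight \<rho> (\<alpha> + axis j 1) = \<rho> $ j / 2 * mweight \<rho> \<alpha>"
proof -
  define P where "P = (\<Prod>k\<in>UNIV - {j}. (\<rho> $ k / 2) ^ (\<alpha> $ k) / fact (\<alpha> $ k))"
  define q where "q = \<rho> $ j / 2"
  have 1: "mweight \<rho> (\<alpha> + axis j 1) = q ^ Suc (\<alpha> $ j) / fact (Suc (\<alpha> $ j)) * P"
    unfolding mweight_alt P_def q_def
    by (subst prod.remove[of _ j]) (auto simp: axis_def intro!: prod.cong)
  have 2: "mweight \<rho> \<alpha> = q ^ (\<alpha> $ j) / fact (\<alpha> $ j) * P"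
    unfolding mweight_alt P_def q_def by (subst prod.remove[of _ j]) auto
  show ?thesis
    unfolding 1 2 q_def[symmetric] by (simp add: field_simps del: of_nat_Suc)
qed

lemma sum_mweight:
  fixes \<rho> :: "real ^ 'd"
  shows "(\<Sum>\<alpha> | mabs \<alpha> = N. mweight \<rho> \<alpha>) = (R_sum \<rho> / 2) ^ N / fact N"
proof (induction N)
  case 0
  have "{\<alpha> :: nat ^ 'd. mabs \<alpha> = 0} = {0}" by (auto simp: mabs_def vec_eq_iff)
  thus ?case by (simp add: mweight_alt)
next
  case (Suc N)
  have "real (Suc N) * (\<Sum>\<alpha> | mabs \<alpha> = Suc N. mweight \<rho> \<alpha>)
      = (\<Sum>\<alpha> | mabs \<alpha> = Suc N. \<Sum>j\<in>UNIV. real (\<alpha> $ j) * mweight \<rho> \<alpha>)"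
    unfolding sum_distrib_left
    by (intro sum.cong refl) (simp add: mabs_def flip: sum_distrib_right of_nat_sum)
  also have "\<dots> = (\<Sum>j\<in>UNIV. \<Sum>\<alpha> | mabs \<alpha> = Suc N. real (\<alpha> $ j) * mweight \<rho> \<alpha>)"
    by (rule sum.swap)
  also have "\<dots> = (\<Sum>j\<in>UNIV. \<rho> $ j / 2 * (\<Sum>\<alpha> | mabs \<alpha> = N. mweight \<rho> \<alpha>))"
  proof (rule sum.cong[OF refl])
    fix j :: 'd
    have inc: "mabs (\<alpha> + axis j 1) = Suc (mabs \<alpha>)" for \<alpha> :: "nat ^ 'd"
      by (simp add: mabs_def sum.distrib axis_def)
    have dec: "\<alpha> - axis j 1 + axis j 1 = \<alpha>" if "\<alpha> $ j \<noteq> 0" for \<alpha> :: "nat ^ 'd"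
      using that by (auto simp: vec_eq_iff axis_def)
    have "(\<Sum>\<alpha> | mabs \<alpha> = Suc N. real (\<alpha> $ j) * mweight \<rho> \<alpha>)
        = (\<Sum>\<alpha> | mabs \<alpha> = Suc N \<and> \<alpha> $ j \<noteq> 0. real (\<alpha> $ j) * mweight \<rho> \<alpha>)"
      by (rule sum.mono_neutral_right) (auto simp: finite_mabs)
    also have "\<dots> = (\<Sum>\<alpha> | mabs \<alpha> = N. real (Suc (\<alpha> $ j)) * mweight \<rho> (\<alpha> + axis j 1))"
    proof (rule sum.reindex_bij_witness[where i = "\<lambda>\<alpha>. \<alpha> + axis j 1" and j = "\<lambda>\<alpha>. \<alpha> - axis j 1"])
      fix \<alpha> :: "nat ^ 'd" assume *: "\<alpha> \<in> {\<alpha>. mabs \<alpha> = Suc N \<and> \<alpha> $ j \<noteq> 0}"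
      show "\<alpha> - axis j 1 + axis j 1 = \<alpha>" using * dec by auto
      show "\<alpha> - axis j 1 \<in> {\<alpha>. mabs \<alpha> = N}" using * dec inc[of "\<alpha> - axis j 1"] by auto
      show "real (Suc ((\<alpha> - axis j 1) $ j)) * mweight \<rho> (\<alpha> - axis j 1 + axis j 1)
              = real (\<alpha> $ j) * mweight \<rho> \<alpha>"
        using * dec by (auto simp: axis_def)
    next
      fix \<alpha> :: "nat ^ 'd" assume *: "\<alpha> \<in> {\<alpha>. mabs \<alpha> = N}"
      show "\<alpha> + axis j 1 - axis j 1 = \<alpha>" by simp
      show "\<alpha> + axis j 1 \<in> {\<alpha>. mabs \<alpha> = Suc N \<and> \<alpha> $ j \<noteq> 0}"
        using * inc by (auto simp: axis_def)
    qed
    also have "\<dots> = \<rho> $ j / 2 * (\<Sum>\<alpha> | mabs \<alpha> = N. mweight \<rho> \<alpha>)"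
      unfolding mweight_incr by (simp add: sum_distrib_left)
    finally show "(\<Sum>\<alpha> | mabs \<alpha> = Suc N. real (\<alpha> $ j) * mweight \<rho> \<alpha>)
        = \<rho> $ j / 2 * (\<Sum>\<alpha> | mabs \<alpha> = N. mweight \<rho> \<alpha>)" .
  qed
  also have "\<dots> = R_sum \<rho> / 2 * ((R_sum \<rho> / 2) ^ N / fact N)"
    unfolding Suc.IH by (simp add: R_sum_def sum_distrib_right sum_divide_distrib)
  finally show ?case by (simp add: field_simps del: of_nat_Suc)
qed

lemma sum_choose_half: "(\<Sum>n\<le>M. real ((m + n) choose n) / 2 ^ n) \<le> 2 ^ Suc m"
proof (induction m)
  case 0
  have "(\<Sum>n\<le>M. 1 / 2 ^ n) = 2 - 1 / (2 :: real) ^ M"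
    by (induction M) (auto simp: field_simps)
  thus ?case by simp
next
  case (Suc m)
  let ?S = "\<lambda>m M. \<Sum>n\<le>M. real ((m + n) choose n) / 2 ^ n"
  have "?S (Suc m) M = ?S m M + (\<Sum>n<M. real ((Suc m + n) choose n) / 2 ^ n) / 2"
    by (induction M) (simp_all add: add_divide_distrib)
  also have "(\<Sum>n<M. real ((Suc m + n) choose n) / 2 ^ n) \<le> ?S (Suc m) M"
    by (rule sum_mono2) auto
  finally have "?S (Suc m) M \<le> ?S m M + ?S (Suc m) M / 2" by simp
  thus ?case using Suc.IH by simp
qed

lemma H_entry_sym: "H_entry \<rho> \<alpha> \<beta> = H_entry \<rho> \<beta> \<alpha>"
  by (simp add: H_entry_def add.commute mult.commute)

lemma abs_H_entry:
  assumes "\<rho> \<in> B_simplex"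
  shows "\<bar>H_entry \<rho> \<alpha> \<beta>\<bar> = fact (mabs \<alpha> + mabs \<beta>) * mweight \<rho> \<alpha> * mweight \<rho> \<beta>"
proof -
  have "0 \<le> (\<Prod>j\<in>UNIV. (\<rho> $ j / 2) ^ (\<gamma> $ j))" for \<gamma> :: "nat ^ 'a"
    by (intro prod_nonneg) (use assms in \<open>auto simp: B_simplex_def\<close>)
  moreover have "0 < mfact \<alpha>" "0 < mfact \<beta>" by (auto simp: mfact_def intro!: prod_pos)
  ultimately show ?thesis
    by (simp add: H_entry_def mweight_def abs_mult power_abs power_add prod.distrib)
qed

lemma row_bound:
  assumes \<rho>: "\<rho> \<in> B_simplex" and G: "finite G"
  shows "(\<Sum>\<beta>\<in>G. \<bar>H_entry \<rho> \<alpha> \<beta>\<bar>) \<le> 2"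
proof -
  let ?m = "mabs \<alpha>"
  obtain M where M: "mabs ` G \<subseteq> {..M}"
    using finite_nat_set_iff_bounded_le[of "mabs ` G"] G by auto
  have R: "0 \<le> R_sum \<rho>" "R_sum \<rho> \<le> 1"
    using \<rho> by (auto simp: B_simplex_def R_sum_def intro!: sum_nonneg)
  have "(\<Sum>\<beta>\<in>G. \<bar>H_entry \<rho> \<alpha> \<beta>\<bar>) = (\<Sum>n\<le>M. \<Sum>\<beta> | \<beta> \<in> G \<and> mabs \<beta> = n. \<bar>H_entry \<rho> \<alpha> \<beta>\<bar>)"
    by (rule sum.group[symmetric, OF G _ M]) simp
  also have "\<dots> \<le> (\<Sum>n\<le>M. \<Sum>\<beta> | mabs \<beta> = n. \<bar>H_entry \<rho> \<alpha> \<beta>\<bar>)"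
    by (intro sum_mono sum_mono2 finite_mabs) auto
  also have "\<dots> = (\<Sum>n\<le>M. fact (?m + n) * mweight \<rho> \<alpha> * ((R_sum \<rho> / 2) ^ n / fact n))"
    unfolding sum_mweight[symmetric] sum_distrib_left
    by (intro sum.cong refl) (simp add: abs_H_entry[OF \<rho>])
  also have "\<dots> \<le> (\<Sum>n\<le>M. fact (?m + n) * mweight \<rho> \<alpha> * ((1 / 2) ^ n / fact n))"
    using R by (intro sum_mono mult_left_mono divide_right_mono power_mono)
      (auto simp: mweight_nonneg[OF \<rho>])
  also have "\<dots> = fact ?m * mweight \<rho> \<alpha> * (\<Sum>n\<le>M. real ((?m + n) choose n) / 2 ^ n)"
    unfolding sum_distrib_left
    by (intro sum.cong refl) (simp add: binomial_fact power_one_over field_simps)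
  also have "\<dots> \<le> fact ?m * mweight \<rho> \<alpha> * 2 ^ Suc ?m"
    by (intro mult_left_mono sum_choose_half) (simp add: mweight_nonneg[OF \<rho>])
  also have "\<dots> \<le> fact ?m * ((R_sum \<rho> / 2) ^ ?m / fact ?m) * 2 ^ Suc ?m"
    unfolding sum_mweight[symmetric]
    by (intro mult_right_mono mult_left_mono member_le_sum)
       (auto simp: finite_mabs mweight_nonneg[OF \<rho>])
  also have "\<dots> = 2 * R_sum \<rho> ^ ?m" by (simp add: power_divide)
  also have "\<dots> \<le> 2" using R by (simp add: power_le_one)
  finally show ?thesis .
qed

lemma H_op_ex1:
  assumes "\<rho> \<in> B_simplex"
  shows "\<exists>!T. bounded_operator T \<and>
    (\<forall>\<alpha> \<beta>. ell2_nth (T (ell2_basis \<beta>)) \<alpha> = complex_of_real (H_entry \<rho> \<alpha> \<beta>))"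
proof -
  obtain T :: "(nat ^ 'a) ell2 \<Rightarrow> (nat ^ 'a) ell2" where T: "bounded_operator T"
    "\<And>\<alpha> \<beta>. ell2_nth (T (ell2_basis \<beta>)) \<alpha> = complex_of_real (H_entry \<rho> \<alpha> \<beta>)"
    by (rule schur_test[where C = 2 and A = "\<lambda>\<alpha> \<beta>. complex_of_real (H_entry \<rho> \<alpha> \<beta>)"])
       (use row_bound[OF assms] in \<open>simp_all add: H_entry_sym[of \<rho> _ \<beta> for \<beta>]\<close>)
  show ?thesis
  proof (rule ex1I[of _ T])
    fix S assume S: "bounded_operator S \<and>
      (\<forall>\<alpha> \<beta>. ell2_nth (S (ell2_basis \<beta>)) \<alpha> = complex_of_real (H_entry \<rho> \<alpha> \<beta>))"
    show "S = T" by (rule bounded_operator_eqI) (use S T in \<open>auto intro!: ell2_eqI\<close>)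
  qed (use T in auto)
qed

lemma h_coef_le:
  assumes "\<rho> \<in> B_simplex"
  shows "h_coef N \<rho> \<le> (R_sum \<rho> / 2) ^ N / fact N"
proof -
  have "h_coef N \<rho> = L2_set (mweight \<rho>) {\<alpha>. mabs \<alpha> = N}"
    unfolding h_coef_def L2_set_def mweight_def
    by (simp add: power_divide prod_power_distrib power_mult[symmetric] mult.commute)
  also have "\<dots> \<le> (\<Sum>\<alpha> | mabs \<alpha> = N. mweight \<rho> \<alpha>)"
    by (rule L2_set_le_sum) (simp add: mweight_nonneg assms)
  finally show ?thesis by (simp add: sum_mweight)
qed

lemma c_coef_bounds:
  assumes "\<rho> \<in> B_simplex"
  shows "0 \<le> c_coef N \<rho>" "c_coef N \<rho> \<le> 1"
proof -
  have R: "0 \<le> R_sum \<rho>" using assms by (auto simp: B_simplex_def R_sum_def intro!: sum_nonneg)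
  have "0 \<le> h_coef N \<rho>" 
    unfolding h_coef_def by (intro real_sqrt_ge_zero sum_nonneg mult_nonneg_nonneg prod_nonneg) auto
  thus "0 \<le> c_coef N \<rho>" using R by (simp add: c_coef_def)
  show "c_coef N \<rho> \<le> 1" unfolding c_coef_def
    by (rule divide_le_eq_1[THEN iffD2]) (use h_coef_le[OF assms, of N] R in auto)
qed

lemma D_op_ex1:
  assumes "\<rho> \<in> B_simplex"
  shows "\<exists>!T. bounded_operator T \<and>
    (\<forall>N. T (ell2_basis N) = complex_of_real (c_coef N \<rho>) *\<^sub>C ell2_basis N)"
proof -
  obtain T :: "nat ell2 \<Rightarrow> nat ell2" where T: "bounded_operator T"
    "\<And>i j. ell2_nth (T (ell2_basis j)) i = (if i = j then complex_of_real (c_coef j \<rho>) else 0)"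
  proof (rule schur_test[where C = 1 and A = "\<lambda>i j. if i = j then complex_of_real (c_coef j \<rho>) else 0"])
    show "(\<Sum>j\<in>G. cmod (if i = j then complex_of_real (c_coef j \<rho>) else 0)) \<le> 1"
      if "finite G" for i G
      using that c_coef_bounds[OF assms] by (simp add: if_distrib cong: if_cong)
    show "(\<Sum>i\<in>G. cmod (if i = j then complex_of_real (c_coef j \<rho>) else 0)) \<le> 1"
      if "finite G" for j G
      using that c_coef_bounds[OF assms] by (simp add: if_distrib cong: if_cong)
  qed blast
  have T': "T (ell2_basis N) = complex_of_real (c_coef N \<rho>) *\<^sub>C ell2_basis N" for N
    by (rule ell2_eqI) (simp add: T scaleC_ell2.rep_eq ell2_basis.rep_eq)
  show ?thesis
  proof (rule ex1I[of _ T])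
    fix S assume S: "bounded_operator S \<and>
      (\<forall>N. S (ell2_basis N) = complex_of_real (c_coef N \<rho>) *\<^sub>C ell2_basis N)"
    show "S = T" by (rule bounded_operator_eqI) (use S T T' in auto)
  qed (use T T' in auto)
qed

lemma H_op:
  assumes "\<rho> \<in> B_simplex"
  shows "bounded_operator (H_op \<rho>)"
    and "ell2_nth (H_op \<rho> (ell2_basis \<beta>)) \<alpha> = complex_of_real (H_entry \<rho> \<alpha> \<beta>)"
  using theI'[OF H_op_ex1[OF assms]] by (auto simp: H_op_def)

lemma D_op:
  assumes "\<rho> \<in> B_simplex"
  shows "bounded_operator (D_op \<rho>)"
    and "D_op \<rho> (ell2_basis N) = complex_of_real (c_coef N \<rho>) *\<^sub>C ell2_basis N"
  using theI'[OF D_op_ex1[OF assms]] by (auto simp: D_op_def)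

end

theory Submission
  imports Defs
begin

text \<open>
  Write \<open>q \<alpha>\<close> for the multinomial probability \<open>|\<alpha>|! / \<alpha>! \<cdot> \<Prod> (\<rho>\<^sub>j / R)\<^bsup>\<alpha>\<^sub>j\<^esup>\<close>. An \<open>\<ell>\<^sup>1\<close> row sum of
  \<open>H\<close> at \<open>\<alpha>\<close> is at most \<open>2 q \<alpha>\<close>, and \<open>c\<^sub>N\<^sup>2 = \<Sum> (q \<alpha>)\<^sup>2\<close> over \<open>|\<alpha>| = N\<close>, which is at most
  \<open>max q\<close>. By the Schur test, a matrix with bounded column sums whose row sums vanish at infinity
  is compact, so everything reduces to \<open>u\<^sub>N = max {q \<alpha> | |\<alpha>| = N} \<rightarrow> 0\<close>.

  As \<open>q \<alpha> = \<Sum> p\<^sub>i q (\<alpha> - e\<^sub>i)\<close> is a convex combination, \<open>u\<close> decreases to some \<open>M\<close>. If \<open>M > 0\<close>, then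
  along maximisers \<open>\<alpha>\<close> every predecessor \<open>\<alpha> - e\<^sub>i\<close> with \<open>p\<^sub>i > 0\<close> also has \<open>q \<rightarrow> M\<close>. Iterating with
  two such directions \<open>j\<close>, \<open>k\<close> gives, for every \<open>l\<close>, the \<open>l + 1\<close> points
  \<open>\<alpha> - a e\<^sub>j - (l - a) e\<^sub>k\<close> on one level, each of probability at least \<open>M / 2\<close>, which is
  impossible for large \<open>l\<close>.
\<close>

section \<open>Compactness from vanishing row sums\<close>

lemma norm_scaleC_ell2: "norm (c *\<^sub>C x) = cmod c * norm x"
  by transfer (simp only: norm_mult power_mult_distrib infsum_cmult_right' real_sqrt_mult
      real_sqrt_abs abs_norm_cancel)

lemma bounded_linear_scaleC_ell2_left: "bounded_linear (\<lambda>c. c *\<^sub>C x)"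
proof (rule bounded_linear_intro)
  show "(c + d) *\<^sub>C x = c *\<^sub>C x + d *\<^sub>C x" for c d
    by (rule ell2_eqI) (simp add: scaleC_ell2.rep_eq plus_ell2.rep_eq distrib_right)
  show "(r *\<^sub>R c) *\<^sub>C x = r *\<^sub>R (c *\<^sub>C x)" for r c
    by (rule ell2_eqI) (simp add: scaleC_ell2.rep_eq scaleR_ell2.rep_eq scaleR_conv_of_real)
  show "norm (c *\<^sub>C x) \<le> norm c * norm x" for c by (simp add: norm_scaleC_ell2)
qed

text \<open>Asking only for some compact superset \<open>K\<close> keeps the induction easy: each
  new coordinate adds the compact image of a disc, and a Minkowski sum of two compact sets is
  compact.\<close>

lemma compact_finite_sections:
  fixes F :: "'i set"
  assumes "finite F"
  shows "\<exists>K. compact K \<and>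
    (\<forall>a. (\<forall>j\<in>F. cmod (a j) \<le> B) \<longrightarrow> (\<Sum>j\<in>F. a j *\<^sub>C ell2_basis j) \<in> K)"
  using assms
proof induction
  case empty
  show ?case by (intro exI[of _ "{0}"]) simp
next
  case (insert i F)
  then obtain K where K: "compact K"
    "\<And>a. (\<forall>j\<in>F. cmod (a j) \<le> B) \<Longrightarrow> (\<Sum>j\<in>F. a j *\<^sub>C ell2_basis j) \<in> K" by blast
  have "compact ((\<lambda>c. c *\<^sub>C (ell2_basis i :: 'i ell2)) ` cball 0 B)"
    by (intro compact_continuous_image compact_cball linear_continuous_on
        bounded_linear_scaleC_ell2_left)
  from compact_sums[OF this K(1)] show ?case
    using insert.hyps K(2) by (fastforce intro!: exI)
qed

text \<open>Uniformly small tails put the image of the unit ball within \<open>e / 3\<close> of its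
  sections on a finite coordinate set; these sections lie in a compact set, so the image is totally
  bounded.\<close>

lemma compact_operatorI:
  fixes T :: "'i ell2 \<Rightarrow> 'j ell2"
  assumes T: "bounded_operator T"
    and tail: "\<And>e. 0 < e \<Longrightarrow> \<exists>F. finite F \<and>
      (\<forall>x G. norm x \<le> 1 \<longrightarrow> finite G \<longrightarrow> G \<inter> F = {} \<longrightarrow> L2_set (\<lambda>i. cmod (ell2_nth (T x) i)) G \<le> e)"
  shows "compact_operator T"
  unfolding compact_operator_def compact_eq_totally_bounded
proof (intro conjI allI impI)
  show "complete (closure (T ` cball 0 1))" by (simp add: complete_eq_closed)
  interpret T: bounded_linear T using T by (simp add: bounded_operator_def)
  obtain B where B: "B > 0" "\<And>x. norm (T x) \<le> norm x * B" using T.pos_bounded by blast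
  fix e :: real assume e: "0 < e"
  then obtain F where F: "finite F" and
    tail: "\<And>x G. norm x \<le> 1 \<Longrightarrow> finite G \<Longrightarrow> G \<inter> F = {} \<Longrightarrow>
      L2_set (\<lambda>i. cmod (ell2_nth (T x) i)) G \<le> e / 3"
    using tail[of "e / 3"] by auto
  let ?P = "\<lambda>y. \<Sum>j\<in>F. ell2_nth y j *\<^sub>C ell2_basis j"
  obtain K where K: "compact K" and
    KP: "\<And>a. (\<forall>j\<in>F. cmod (a j) \<le> B) \<Longrightarrow> (\<Sum>j\<in>F. a j *\<^sub>C ell2_basis j) \<in> K"
    using compact_finite_sections[OF F, of B] by blast
  obtain k where k: "finite k" "K \<subseteq> (\<Union>x\<in>k. ball x (e / 3))"
    using K e unfolding compact_eq_totally_bounded by (metis zero_less_divide_iff zero_less_numeral)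
  \<comment> \<open>Closed balls are used because their finite union is closed and so also contains
    the closure; the radius \<open>2 * e / 3\<close> leaves room to pass to open balls of radius
    \<open>e\<close>.\<close>
  have "T ` cball 0 1 \<subseteq> (\<Union>c\<in>k. cball c (2 * e / 3))"
  proof
    fix y assume "y \<in> T ` cball 0 1"
    then obtain x where x: "norm x \<le> 1" "y = T x" by auto
    have "norm y \<le> 1 * B"
      unfolding x(2) by (rule order_trans[OF B(2)]) (use x B in \<open>auto intro: mult_right_mono\<close>)
    hence "?P y \<in> K" by (intro KP) (auto intro: order_trans[OF norm_ell2_nth_le])
    then obtain c where c: "c \<in> k" "dist c (?P y) < e / 3" using k by auto
    have "norm (y - ?P y) \<le> e / 3"
    proof (rule norm_le_of_L2_set)
      fix G :: "'j set" assume G: "finite G"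
      \<comment> \<open>Coordinates in \<open>F\<close> cancel, so only \<open>G - F\<close>
        contributes and the tail hypothesis applies.\<close>
      have "(\<Sum>i\<in>G. (cmod (ell2_nth (y - ?P y) i))\<^sup>2) = (\<Sum>i\<in>G - F. (cmod (ell2_nth y i))\<^sup>2)"
        by (rule sum.mono_neutral_cong_right)
           (use G in \<open>auto simp: minus_ell2.rep_eq ell2_finite_section F\<close>)
      thus "L2_set (\<lambda>i. cmod (ell2_nth (y - ?P y) i)) G \<le> e / 3"
        using tail[OF x(1), of "G - F"] G by (simp add: L2_set_def x(2) Diff_Int_distrib2)
    qed (use e in auto)
    with c(2) have "dist c y \<le> 2 * e / 3"
      using dist_triangle[of c y "?P y"] by (simp add: dist_norm norm_minus_commute)
    with c(1) show "y \<in> (\<Union>c\<in>k. cball c (2 * e / 3))" by auto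
  qed
  hence "closure (T ` cball 0 1) \<subseteq> (\<Union>c\<in>k. cball c (2 * e / 3))"
    by (rule closure_minimal) (use k in auto)
  also have "\<dots> \<subseteq> (\<Union>c\<in>k. ball c e)" using e by (intro UN_mono) auto
  finally show "\<exists>k. finite k \<and> closure (T ` cball 0 1) \<subseteq> (\<Union>c\<in>k. ball c e)" using k by blast
qed (rule T)

text \<open>Schur's argument restricted to the rows in \<open>F\<close>: Cauchy-Schwarz with weights
  \<open>cmod (A i j)\<close> uses the row sums once and the column sums once. Keeping
  \<open>r\<close> and \<open>C\<close> apart means that small rows alone make the bound
  small.\<close>

lemma schur_bound:
  fixes A :: "'i \<Rightarrow> 'j \<Rightarrow> complex"
  assumes T: "bounded_operator T" "\<And>i j. ell2_nth (T (ell2_basis j)) i = A i j"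
    and F: "finite F"
    and row: "\<And>i G. i \<in> F \<Longrightarrow> finite G \<Longrightarrow> (\<Sum>j\<in>G. cmod (A i j)) \<le> r"
    and col: "\<And>j. (\<Sum>i\<in>F. cmod (A i j)) \<le> C"
    and r: "0 \<le> r" and C: "0 \<le> C"
  shows "L2_set (\<lambda>i. cmod (ell2_nth (T x) i)) F \<le> sqrt (r * C) * norm x"
proof (rule field_le_epsilon)
  interpret T: bounded_linear T using T by (simp add: bounded_operator_def)
  obtain K where K: "K > 0" "\<And>x. norm (T x) \<le> norm x * K" using T.pos_bounded by blast
  fix e :: real assume e: "0 < e"
  \<comment> \<open>The matrix entries determine \<open>T\<close> directly only on finite
    combinations of basis vectors; the error \<open>e / K\<close> costs at most \<open>e\<close>
    after applying \<open>T\<close>.\<close>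
  obtain G where G: "finite G" "norm (x - (\<Sum>j\<in>G. ell2_nth x j *\<^sub>C ell2_basis j)) \<le> e / K"
    by (rule ell2_approx[of "e / K" x]) (use e K in auto)
  define y where "y = (\<Sum>j\<in>G. ell2_nth x j *\<^sub>C ell2_basis j)"
  let ?a = "\<lambda>i j. cmod (A i j)" and ?x = "\<lambda>j. cmod (ell2_nth x j)"
  have "T y = (\<Sum>j\<in>G. ell2_nth x j *\<^sub>C T (ell2_basis j))"
    using T(1) by (simp add: y_def T.sum bounded_operator_def)
  hence Ty: "ell2_nth (T y) i = (\<Sum>j\<in>G. A i j * ell2_nth x j)" for i
    by (simp add: ell2_nth_sum scaleC_ell2.rep_eq T(2) mult.commute)
  have "(cmod (ell2_nth (T y) i))\<^sup>2 \<le> r * (\<Sum>j\<in>G. ?a i j * (?x j)\<^sup>2)" if i: "i \<in> F" for i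
  proof -
    have "cmod (ell2_nth (T y) i) \<le> (\<Sum>j\<in>G. \<bar>sqrt (?a i j)\<bar> * \<bar>sqrt (?a i j) * ?x j\<bar>)"
      unfolding Ty by (rule order_trans[OF norm_sum]) (simp add: norm_mult abs_mult flip: mult.assoc)
    also have "\<dots> \<le> L2_set (\<lambda>j. sqrt (?a i j)) G * L2_set (\<lambda>j. sqrt (?a i j) * ?x j) G"
      by (rule L2_set_mult_ineq)
    finally have "(cmod (ell2_nth (T y) i))\<^sup>2
        \<le> (L2_set (\<lambda>j. sqrt (?a i j)) G * L2_set (\<lambda>j. sqrt (?a i j) * ?x j) G)\<^sup>2"
      by (intro power_mono) auto
    also have "\<dots> = (\<Sum>j\<in>G. ?a i j) * (\<Sum>j\<in>G. ?a i j * (?x j)\<^sup>2)"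
      by (simp add: L2_set_def power_mult_distrib sum_nonneg)
    also have "\<dots> \<le> r * (\<Sum>j\<in>G. ?a i j * (?x j)\<^sup>2)"
      by (intro mult_right_mono row i G sum_nonneg) auto
    finally show ?thesis .
  qed
  hence "(\<Sum>i\<in>F. (cmod (ell2_nth (T y) i))\<^sup>2) \<le> (\<Sum>i\<in>F. r * (\<Sum>j\<in>G. ?a i j * (?x j)\<^sup>2))"
    by (rule sum_mono)
  also have "\<dots> = r * (\<Sum>j\<in>G. (\<Sum>i\<in>F. ?a i j) * (?x j)\<^sup>2)"
    unfolding sum_distrib_left[symmetric] sum_distrib_right by (subst sum.swap) (rule refl)
  also have "\<dots> \<le> r * (\<Sum>j\<in>G. C * (?x j)\<^sup>2)"
    by (intro mult_left_mono sum_mono mult_right_mono col r) auto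
  also have "\<dots> \<le> r * C * (norm x)\<^sup>2"
    unfolding norm_ell2_sq sum_distrib_left[symmetric] mult.assoc
    by (intro mult_left_mono finite_sum_le_infsum square_summable_ell2 G r C) auto
  finally have 1: "L2_set (\<lambda>i. cmod (ell2_nth (T y) i)) F \<le> sqrt (r * C) * norm x"
    using r C by (subst L2_set_le_iff) (auto simp: power_mult_distrib)
  have "norm (T (x - y)) \<le> e"
    using K(2)[of "x - y"] G(2) K(1) by (simp add: y_def pos_le_divide_eq)
  hence 2: "L2_set (\<lambda>i. cmod (ell2_nth (T (x - y)) i)) F \<le> e"
    using L2_set_le_norm[OF F] order_trans by blast
  have "T x = T y + T (x - y)" by (simp add: T.diff)
  thus "L2_set (\<lambda>i. cmod (ell2_nth (T x) i)) F \<le> sqrt (r * C) * norm x + e"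
    using L2_set_add_le[of "ell2_nth (T y)" "ell2_nth (T (x - y))" F] 1 2
    by (simp add: plus_ell2.rep_eq)
qed

lemma compact_operator_of_vanishing_rows:
  fixes A :: "'i \<Rightarrow> 'j \<Rightarrow> complex"
  assumes T: "bounded_operator T" "\<And>i j. ell2_nth (T (ell2_basis j)) i = A i j"
    and row: "\<And>i G. finite G \<Longrightarrow> (\<Sum>j\<in>G. cmod (A i j)) \<le> r i"
    and col: "\<And>j F. finite F \<Longrightarrow> (\<Sum>i\<in>F. cmod (A i j)) \<le> C"
    and r: "\<And>e. 0 < e \<Longrightarrow> finite {i. e < r i}"
  shows "compact_operator T"
proof (rule compact_operatorI[OF T(1)])
  fix e :: real assume e: "0 < e"
  have C: "0 \<le> C" using col[of "{}"] by simp
  \<comment> \<open>Chosen so that \<open>d * C \<le> e^2\<close>; the summand 1 keeps the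
    denominator positive when \<open>C = 0\<close>.\<close>
  define d where "d = e\<^sup>2 / (C + 1)"
  have d: "0 < d" using e C by (simp add: d_def)
  have "d * C \<le> e\<^sup>2" using C by (simp add: d_def field_simps)
  hence dC: "sqrt (d * C) \<le> e" using e by (simp add: real_le_lsqrt)
  have "L2_set (\<lambda>i. cmod (ell2_nth (T x) i)) G \<le> e"
    if x: "norm x \<le> 1" and G: "finite G" "G \<inter> {i. d < r i} = {}" for x G
  proof -
    have "L2_set (\<lambda>i. cmod (ell2_nth (T x) i)) G \<le> sqrt (d * C) * norm x"
      by (rule schur_bound[OF T G(1)])
         (use G d C col in \<open>auto intro!: order_trans[OF row]\<close>)
    also have "\<dots> \<le> e * 1" using x e dC by (intro mult_mono) auto
    finally show ?thesis by simp
  qed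
  thus "\<exists>F. finite F \<and> (\<forall>x G. norm x \<le> 1 \<longrightarrow> finite G \<longrightarrow> G \<inter> F = {} \<longrightarrow>
      L2_set (\<lambda>i. cmod (ell2_nth (T x) i)) G \<le> e)"
    using r[OF d] by blast
qed

section \<open>Multinomial probabilities\<close>

text \<open>This is the \<open>q\<close> of the overview: the powers of 2 in \<open>mweight\<close>
  and in the denominator cancel, leaving the multinomial probability with parameters
  \<open>\<rho> $ i / R_sum \<rho>\<close>.\<close>

definition mprob :: "real ^ 'd \<Rightarrow> nat ^ 'd \<Rightarrow> real" where
  "mprob \<rho> \<alpha> = fact (mabs \<alpha>) * mweight \<rho> \<alpha> / (R_sum \<rho> / 2) ^ mabs \<alpha>"

lemma R_sum_nonneg: "\<rho> \<in> B_simplex \<Longrightarrow> 0 \<le> R_sum \<rho>"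
  by (auto simp: B_simplex_def R_sum_def intro!: sum_nonneg)

lemma mprob_nonneg: "\<rho> \<in> B_simplex \<Longrightarrow> 0 \<le> mprob \<rho> \<alpha>"
  by (simp add: mprob_def mweight_nonneg R_sum_nonneg)

lemma sum_mprob:
  assumes "R_sum \<rho> \<noteq> 0"
  shows "(\<Sum>\<alpha> | mabs \<alpha> = N. mprob \<rho> \<alpha>) = 1"
proof -
  have "(\<Sum>\<alpha> | mabs \<alpha> = N. mprob \<rho> \<alpha>)
      = fact N / (R_sum \<rho> / 2) ^ N * (\<Sum>\<alpha> | mabs \<alpha> = N. mweight \<rho> \<alpha>)"
    unfolding sum_distrib_left by (intro sum.cong) (auto simp: mprob_def)
  thus ?thesis using assms by (simp add: sum_mweight)
qed

lemma mabs_add_axis: "mabs (\<alpha> + axis i n) = mabs \<alpha> + n"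
  by (simp add: mabs_def sum.distrib axis_def)

lemma diff_axis_add_axis: "n \<le> \<alpha> $ i \<Longrightarrow> \<alpha> - axis i n + axis i n = (\<alpha> :: nat ^ 'd)"
  by (auto simp: vec_eq_iff axis_def)

lemma mabs_diff_axis: "n \<le> \<alpha> $ i \<Longrightarrow> mabs (\<alpha> - axis i n) = mabs \<alpha> - n"
  using mabs_add_axis[of "\<alpha> - axis i n" i n] by (simp add: diff_axis_add_axis)

text \<open>Condition on the outcome of the last draw; algebraically, sum
  \<open>mweight_incr\<close> over all directions and use that the coordinates add up to
  \<open>mabs \<alpha>\<close>. The guard is needed because truncated subtraction would turn a
  missing predecessor into \<open>\<alpha>\<close> itself.\<close>

lemma mprob_rec:
  assumes R: "0 < R_sum \<rho>" and \<alpha>: "0 < mabs \<alpha>"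
  shows "mprob \<rho> \<alpha> =
    (\<Sum>i\<in>UNIV. \<rho> $ i / R_sum \<rho> * (if \<alpha> $ i = 0 then 0 else mprob \<rho> (\<alpha> - axis i 1)))"
proof -
  obtain m where m: "mabs \<alpha> = Suc m" using \<alpha> by (cases "mabs \<alpha>") auto
  have summand: "fact m / (R_sum \<rho> / 2) ^ Suc m * (real (\<alpha> $ i) * mweight \<rho> \<alpha>)
      = \<rho> $ i / R_sum \<rho> * (if \<alpha> $ i = 0 then 0 else mprob \<rho> (\<alpha> - axis i 1))" for i
  proof (cases "\<alpha> $ i = 0")
    case False
    have "real (\<alpha> $ i) * mweight \<rho> \<alpha> = \<rho> $ i / 2 * mweight \<rho> (\<alpha> - axis i 1)"
      using mweight_incr[of "\<alpha> - axis i 1" i \<rho>] False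
      by (simp add: diff_axis_add_axis Suc_leI del: of_nat_Suc)
    thus ?thesis using False R by (simp add: mprob_def mabs_diff_axis m field_simps)
  qed simp
  have "mprob \<rho> \<alpha> = fact m / (R_sum \<rho> / 2) ^ Suc m * (real (mabs \<alpha>) * mweight \<rho> \<alpha>)"
    by (simp add: mprob_def m)
  also have "real (mabs \<alpha>) * mweight \<rho> \<alpha> = (\<Sum>i\<in>UNIV. real (\<alpha> $ i) * mweight \<rho> \<alpha>)"
    by (simp add: mabs_def sum_distrib_right)
  finally show ?thesis unfolding sum_distrib_left summand .
qed

section \<open>Decay of the largest multinomial probability on a level\<close>

definition max_mprob :: "real ^ 'd \<Rightarrow> nat \<Rightarrow> real" where
  "max_mprob \<rho> N = Max (mprob \<rho> ` {\<alpha>. mabs \<alpha> = N})"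

lemma mabs_level_nonempty: "{\<alpha> :: nat ^ 'd. mabs \<alpha> = N} \<noteq> {}"
proof -
  have "mabs (axis undefined N :: nat ^ 'd) = N"
    using mabs_add_axis[of "0 :: nat ^ 'd" undefined N] by (simp add: mabs_def)
  thus ?thesis by blast
qed

lemma mprob_le_max: "mprob \<rho> \<alpha> \<le> max_mprob \<rho> (mabs \<alpha>)"
  unfolding max_mprob_def by (intro Max_ge finite_imageI finite_mabs) auto

lemma max_mprob_attained: "\<exists>\<alpha>. mabs \<alpha> = N \<and> mprob \<rho> \<alpha> = max_mprob \<rho> N"
proof -
  have "max_mprob \<rho> N \<in> mprob \<rho> ` {\<alpha>. mabs \<alpha> = N}"
    unfolding max_mprob_def
    by (intro Max_in finite_imageI finite_mabs) (use mabs_level_nonempty in blast)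
  thus ?thesis by auto
qed

lemma max_mprob_nonneg: "\<rho> \<in> B_simplex \<Longrightarrow> 0 \<le> max_mprob \<rho> N"
  using max_mprob_attained[of N \<rho>] mprob_nonneg by metis

text \<open>One term of the convex combination is kept and the others are replaced by the maximum.
  Read as an upper bound, this yields monotonicity of \<open>max_mprob\<close>; solved for the kept
  term, it bounds a predecessor from below.\<close>

lemma mprob_step_le:
  fixes \<rho> :: "real ^ 'd"
  assumes \<rho>: "\<rho> \<in> B_simplex" and R: "0 < R_sum \<rho>" and \<alpha>: "mabs \<alpha> = Suc N"
  shows "mprob \<rho> \<alpha> \<le> \<rho> $ i / R_sum \<rho> * (if \<alpha> $ i = 0 then 0 else mprob \<rho> (\<alpha> - axis i 1))
    + (1 - \<rho> $ i / R_sum \<rho>) * max_mprob \<rho> N"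
proof -
  let ?p = "\<lambda>i. \<rho> $ i / R_sum \<rho>"
  let ?q = "\<lambda>i. if \<alpha> $ i = 0 then 0 else mprob \<rho> (\<alpha> - axis i 1)"
  have q: "?q l \<le> max_mprob \<rho> N" for l
    using mprob_le_max[of \<rho> "\<alpha> - axis l 1"] max_mprob_nonneg[OF \<rho>]
    by (auto simp: mabs_diff_axis \<alpha>)
  have "(\<Sum>l\<in>UNIV. ?p l) = 1" using R by (simp add: R_sum_def flip: sum_divide_distrib)
  hence p: "(\<Sum>l\<in>UNIV - {i}. ?p l) = 1 - ?p i" by (simp add: sum_diff1)
  have "mprob \<rho> \<alpha> = ?p i * ?q i + (\<Sum>l\<in>UNIV - {i}. ?p l * ?q l)"
    using \<alpha> by (subst mprob_rec[OF R]) (auto simp: sum.remove[of UNIV i])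
  also have "(\<Sum>l\<in>UNIV - {i}. ?p l * ?q l) \<le> (\<Sum>l\<in>UNIV - {i}. ?p l * max_mprob \<rho> N)"
    using \<rho> R by (intro sum_mono mult_left_mono q) (auto simp: B_simplex_def)
  also have "\<dots> = (1 - ?p i) * max_mprob \<rho> N" unfolding p[symmetric] sum_distrib_right ..
  finally show ?thesis by simp
qed

lemma decseq_max_mprob:
  assumes \<rho>: "\<rho> \<in> B_simplex" and R: "0 < R_sum \<rho>"
  shows "decseq (max_mprob \<rho>)"
proof (rule decseq_SucI)
  fix N
  obtain \<alpha> where \<alpha>: "mabs \<alpha> = Suc N" "mprob \<rho> \<alpha> = max_mprob \<rho> (Suc N)"
    using max_mprob_attained by blast
  have "\<exists>i. \<alpha> $ i \<noteq> 0" by (rule ccontr) (use \<alpha>(1) in \<open>simp add: mabs_def\<close>)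
  then obtain i where i: "\<alpha> $ i \<noteq> 0" by blast
  have "mprob \<rho> (\<alpha> - axis i 1) \<le> max_mprob \<rho> N"
    using mprob_le_max[of \<rho> "\<alpha> - axis i 1"] i by (simp add: mabs_diff_axis \<alpha>)
  hence "\<rho> $ i / R_sum \<rho> * mprob \<rho> (\<alpha> - axis i 1) \<le> \<rho> $ i / R_sum \<rho> * max_mprob \<rho> N"
    using \<rho> R by (intro mult_left_mono) (auto simp: B_simplex_def)
  thus "max_mprob \<rho> (Suc N) \<le> max_mprob \<rho> N"
    using mprob_step_le[OF \<rho> R \<alpha>(1), of i] i \<alpha>(2) by (simp add: algebra_simps)
qed

text \<open>An average close to \<open>M\<close> of terms asymptotically at most \<open>M\<close>
  forces every term of fixed positive weight close to \<open>M\<close>.\<close>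

lemma near_max_predecessor:
  fixes \<alpha> :: "nat \<Rightarrow> nat ^ 'd"
  assumes \<rho>: "\<rho> \<in> B_simplex" and i: "0 < \<rho> $ i" and R: "0 < R_sum \<rho>"
    and M: "max_mprob \<rho> \<longlonglongrightarrow> M" "0 < M"
    and \<alpha>: "filterlim (\<lambda>n. mabs (\<alpha> n)) at_top sequentially" "(\<lambda>n. mprob \<rho> (\<alpha> n)) \<longlonglongrightarrow> M"
  shows "\<forall>\<^sub>F n in sequentially. 1 \<le> \<alpha> n $ i"
    and "(\<lambda>n. mprob \<rho> (\<alpha> n - axis i 1)) \<longlonglongrightarrow> M"
proof -
  define p where "p = \<rho> $ i / R_sum \<rho>"
  have p: "0 < p" using i R by (simp add: p_def)
  define q where "q n = (if \<alpha> n $ i = 0 then 0 else mprob \<rho> (\<alpha> n - axis i 1))" for n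
  have pred: "filterlim (\<lambda>n. mabs (\<alpha> n) - 1) at_top sequentially"
    by (rule filterlim_compose[OF _ \<alpha>(1)]) (rule filterlim_minus_const_nat_at_top)
  have u: "(\<lambda>n. max_mprob \<rho> (mabs (\<alpha> n) - 1)) \<longlonglongrightarrow> M"
    by (rule filterlim_compose[OF M(1) pred])
  have ev: "\<forall>\<^sub>F n in sequentially. 1 \<le> mabs (\<alpha> n)"
    using \<alpha>(1) by (simp add: filterlim_at_top)
  have q: "q \<longlonglongrightarrow> M"
  \<comment> \<open>The lower bound is \<open>mprob_step_le\<close> solved for \<open>q n\<close>,
    and both bounds tend to \<open>M\<close>.\<close>
  proof (rule tendsto_sandwich[OF _ _ _ u])
    show "\<forall>\<^sub>F n in sequentially. (mprob \<rho> (\<alpha> n) - (1 - p) * max_mprob \<rho> (mabs (\<alpha> n) - 1)) / p \<le> q n"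
      using ev
    proof eventually_elim
      case (elim n)
      thus ?case using mprob_step_le[OF \<rho> R, of "\<alpha> n" "mabs (\<alpha> n) - 1" i] p
        unfolding q_def p_def[symmetric] by (simp add: pos_divide_le_eq mult.commute)
    qed
    have "q n \<le> max_mprob \<rho> (mabs (\<alpha> n) - 1)" for n
      using mprob_le_max[of \<rho> "\<alpha> n - axis i 1"] mabs_diff_axis[of 1 "\<alpha> n" i]
        max_mprob_nonneg[OF \<rho>] by (auto simp: q_def Suc_leI)
    thus "\<forall>\<^sub>F n in sequentially. q n \<le> max_mprob \<rho> (mabs (\<alpha> n) - 1)" by simp
    have "(\<lambda>n. (mprob \<rho> (\<alpha> n) - (1 - p) * max_mprob \<rho> (mabs (\<alpha> n) - 1)) / p)
        \<longlonglongrightarrow> (M - (1 - p) * M) / p"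
      using p by (intro tendsto_intros \<alpha>(2) u) auto
    thus "(\<lambda>n. (mprob \<rho> (\<alpha> n) - (1 - p) * max_mprob \<rho> (mabs (\<alpha> n) - 1)) / p) \<longlonglongrightarrow> M"
      using p by (simp add: algebra_simps)
  qed
  \<comment> \<open>Since \<open>M > 0\<close>, the default value 0 of \<open>q\<close> is
    eventually excluded, so the predecessor really exists.\<close>
  have "\<forall>\<^sub>F n in sequentially. 0 < q n" using q M(2) by (rule order_tendstoD)
  thus pos: "\<forall>\<^sub>F n in sequentially. 1 \<le> \<alpha> n $ i"
    by eventually_elim (auto simp: q_def split: if_splits)
  show "(\<lambda>n. mprob \<rho> (\<alpha> n - axis i 1)) \<longlonglongrightarrow> M"
    by (rule Lim_transform_eventually[OF q], use pos in eventually_elim) (simp add: q_def)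
qed

text \<open>Iterates \<open>near_max_predecessor\<close>. The three conclusions are proved together:
  levels tending to infinity and probabilities tending to \<open>M\<close> allow the next step, and
  the coordinate bound ensures that nothing is truncated.\<close>

lemma near_max_predecessors:
  fixes \<alpha> :: "nat \<Rightarrow> nat ^ 'd"
  assumes \<rho>: "\<rho> \<in> B_simplex" and i: "0 < \<rho> $ i" and R: "0 < R_sum \<rho>"
    and M: "max_mprob \<rho> \<longlonglongrightarrow> M" "0 < M"
    and \<alpha>: "filterlim (\<lambda>n. mabs (\<alpha> n)) at_top sequentially" "(\<lambda>n. mprob \<rho> (\<alpha> n)) \<longlonglongrightarrow> M"
  shows "(\<forall>\<^sub>F n in sequentially. a \<le> \<alpha> n $ i) \<and>
    filterlim (\<lambda>n. mabs (\<alpha> n - axis i a)) at_top sequentially \<and>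
    (\<lambda>n. mprob \<rho> (\<alpha> n - axis i a)) \<longlonglongrightarrow> M"
proof (induction a)
  case 0
  have "axis i 0 = (0 :: nat ^ 'd)" by (simp add: vec_eq_iff axis_def)
  thus ?case using \<alpha> by (simp only:) simp
next
  case (Suc a)
  let ?\<beta> = "\<lambda>n. \<alpha> n - axis i a"
  have eq: "?\<beta> n - axis i 1 = \<alpha> n - axis i (Suc a)" for n
    by (simp add: vec_eq_iff axis_def)
  note step = near_max_predecessor[OF \<rho> i R M, of ?\<beta>, unfolded eq]
  have ge: "\<forall>\<^sub>F n in sequentially. Suc a \<le> \<alpha> n $ i"
    using step(1) Suc by (auto elim!: eventually_mono simp: axis_def)
  have "filterlim (\<lambda>n. mabs (\<alpha> n) - Suc a) at_top sequentially"
    by (rule filterlim_compose[OF _ \<alpha>(1)]) (rule filterlim_minus_const_nat_at_top)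
  hence "filterlim (\<lambda>n. mabs (\<alpha> n - axis i (Suc a))) at_top sequentially"
    by (rule filterlim_mono_eventually[OF _ order_refl order_refl])
       (use ge in \<open>auto elim!: eventually_mono simp: mabs_diff_axis\<close>)
  thus ?case using ge step(2) Suc by blast
qed

lemma max_mprob_tendsto_0:
  fixes \<rho> :: "real ^ 'd"
  assumes \<rho>: "\<rho> \<in> B_simplex" and j: "0 < \<rho> $ j" and k: "0 < \<rho> $ k" and jk: "j \<noteq> k"
    and R: "0 < R_sum \<rho>"
  shows "max_mprob \<rho> \<longlonglongrightarrow> 0"
proof -
  obtain M where M: "max_mprob \<rho> \<longlonglongrightarrow> M" "\<And>n. M \<le> max_mprob \<rho> n"
    using decseq_convergent[OF decseq_max_mprob[OF \<rho> R], of 0] max_mprob_nonneg[OF \<rho>] by blast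
  have "M \<ge> 0" using M(1) max_mprob_nonneg[OF \<rho>] by (intro LIMSEQ_le_const) auto
  moreover have "\<not> 0 < M"
  proof
    assume M0: "0 < M"
    obtain \<alpha> where \<alpha>: "\<And>n. mabs (\<alpha> n) = n" "\<And>n. mprob \<rho> (\<alpha> n) = max_mprob \<rho> n"
      using max_mprob_attained[of _ \<rho>] by metis
    \<comment> \<open>With this \<open>l\<close>, the \<open>l + 1\<close> points found below, each
      of probability above \<open>M / 2\<close>, would have total mass above 1.\<close>
    obtain l where l: "2 / M < real l" using reals_Archimedean2 by blast
    let ?\<beta> = "\<lambda>n a. \<alpha> n - axis j a - axis k (l - a)"
    have "\<forall>\<^sub>F n in sequentially. a \<le> \<alpha> n $ j \<and> l - a \<le> \<alpha> n $ k \<and> M / 2 < mprob \<rho> (?\<beta> n a)" for a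
    proof -
      note 1 = near_max_predecessors[OF \<rho> j R M(1) M0, of \<alpha> a]
      \<comment> \<open>The moves along \<open>k\<close> start from the sequence already moved along
        \<open>j\<close>; fact \<open>1\<close> shows that this sequence still satisfies the
        hypotheses.\<close>
      note 2 = near_max_predecessors[OF \<rho> k R M(1) M0, of "\<lambda>n. \<alpha> n - axis j a" "l - a"]
      have \<alpha>_near_max: "filterlim (\<lambda>n. mabs (\<alpha> n)) at_top sequentially"
        "(\<lambda>n. mprob \<rho> (\<alpha> n)) \<longlonglongrightarrow> M"
        using M(1) by (simp_all add: \<alpha> filterlim_ident)
      have lim: "(\<lambda>n. mprob \<rho> (?\<beta> n a)) \<longlonglongrightarrow> M" using 1 2 \<alpha>_near_max by blast
      have "\<forall>\<^sub>F n in sequentially. M / 2 < mprob \<rho> (?\<beta> n a)"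
        by (rule order_tendstoD(1)[OF lim]) (use M0 in simp)
      moreover have "\<forall>\<^sub>F n in sequentially. a \<le> \<alpha> n $ j" using 1 \<alpha>_near_max by blast
      moreover have "\<forall>\<^sub>F n in sequentially. l - a \<le> (\<alpha> n - axis j a) $ k"
        using 1 2 \<alpha>_near_max by blast
      ultimately show ?thesis by eventually_elim (use jk in \<open>auto simp: axis_def\<close>)
    qed
    \<comment> \<open>Only finitely many \<open>a\<close> occur, so a single \<open>n\<close> serves
      all of them.\<close>
    hence "\<forall>\<^sub>F n in sequentially. \<forall>a\<in>{..l}.
        a \<le> \<alpha> n $ j \<and> l - a \<le> \<alpha> n $ k \<and> M / 2 < mprob \<rho> (?\<beta> n a)"
      by (intro eventually_ball_finite) auto
    then obtain n where n: "\<And>a. a \<le> l \<Longrightarrow> a \<le> \<alpha> n $ j \<and> l - a \<le> \<alpha> n $ k \<and> M / 2 < mprob \<rho> (?\<beta> n a)"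
      by (auto dest!: eventually_happens)
    \<comment> \<open>The \<open>j\<close>-coordinate recovers \<open>a\<close>: subtracting along
      \<open>k\<close> leaves it unchanged, and \<open>a \<le> \<alpha> n $ j\<close> rules out
      truncation.\<close>
    have "inj_on (?\<beta> n) {..l}"
    proof (rule inj_onI)
      fix a b assume ab: "a \<in> {..l}" "b \<in> {..l}" "?\<beta> n a = ?\<beta> n b"
      hence "?\<beta> n a $ j = ?\<beta> n b $ j" by simp
      hence "\<alpha> n $ j - a = \<alpha> n $ j - b" using jk by (simp add: axis_def)
      moreover have "a \<le> \<alpha> n $ j" "b \<le> \<alpha> n $ j" using n ab by auto
      ultimately show "a = b" by linarith
    qed
    moreover have "mabs (?\<beta> n a) = n - l" if "a \<le> l" for a
    proof -
      have "mabs (\<alpha> n - axis j a) = n - a" using n[OF that] by (simp add: mabs_diff_axis \<alpha>(1))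
      moreover have "l - a \<le> (\<alpha> n - axis j a) $ k"
        using n[OF that] jk by (simp add: axis_def)
      ultimately show ?thesis using that by (simp add: mabs_diff_axis)
    qed
    \<comment> \<open>The points are distinct and lie on the common level \<open>n - l\<close>,
      whose total probability is 1.\<close>
    ultimately have "(\<Sum>a\<le>l. mprob \<rho> (?\<beta> n a)) \<le> (\<Sum>\<alpha> | mabs \<alpha> = n - l. mprob \<rho> \<alpha>)"
      by (subst sum.reindex[symmetric, unfolded o_def])
         (auto intro!: sum_mono2 finite_mabs mprob_nonneg \<rho>)
    also have "\<dots> = 1" using R by (intro sum_mprob) simp
    finally have "(\<Sum>a\<le>l. mprob \<rho> (?\<beta> n a)) \<le> 1" .
    moreover have "(\<Sum>a\<le>l. M / 2) \<le> (\<Sum>a\<le>l. mprob \<rho> (?\<beta> n a))"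
      using n by (intro sum_mono) (auto intro: less_imp_le)
    ultimately have "real (Suc l) * (M / 2) \<le> 1" by simp
    moreover have "1 < real l * (M / 2)" using l M0 by (simp add: field_simps)
    ultimately show False using M0 by (simp add: field_simps)
  qed
  ultimately show ?thesis using M(1) by simp
qed

text \<open>Turns decay along levels into the finiteness condition of the compactness criterion,
  since each level is finite.\<close>

lemma finite_mprob_large:
  fixes \<rho> :: "real ^ 'd"
  assumes "max_mprob \<rho> \<longlonglongrightarrow> 0" "0 < e"
  shows "finite {\<alpha>. e < mprob \<rho> \<alpha>}"
proof -
  obtain N where N: "\<And>n. N \<le> n \<Longrightarrow> max_mprob \<rho> n < e"
    using order_tendstoD(2)[OF assms] by (auto simp: eventually_sequentially)
  have "{\<alpha>. e < mprob \<rho> \<alpha>} \<subseteq> (\<Union>n<N. {\<alpha>. mabs \<alpha> = n})"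
  proof
    fix \<alpha> assume "\<alpha> \<in> {\<alpha>. e < mprob \<rho> \<alpha>}"
    hence "\<not> max_mprob \<rho> (mabs \<alpha>) < e" using mprob_le_max[of \<rho> \<alpha>] by simp
    hence "mabs \<alpha> < N" using N by (meson not_le)
    thus "\<alpha> \<in> (\<Union>n<N. {\<alpha>. mabs \<alpha> = n})" by simp
  qed
  thus ?thesis by (rule finite_subset) (simp add: finite_mabs)
qed

section \<open>The operators \<open>D\<close> and \<open>H\<close>\<close>

lemma c_coef_le_sqrt_max_mprob:
  assumes \<rho>: "\<rho> \<in> B_simplex" and R: "0 < R_sum \<rho>"
  shows "c_coef N \<rho> \<le> sqrt (max_mprob \<rho> N)"
proof -
  let ?L = "{\<alpha> :: nat ^ 'a. mabs \<alpha> = N}"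
  have "h_coef N \<rho> = L2_set (mweight \<rho>) ?L"
    unfolding h_coef_def L2_set_def mweight_def
    by (simp add: power_divide prod_power_distrib power_mult[symmetric] mult.commute)
  hence "c_coef N \<rho> = fact N / (R_sum \<rho> / 2) ^ N * L2_set (mweight \<rho>) ?L"
    by (simp add: c_coef_def)
  also have "\<dots> = L2_set (\<lambda>\<alpha>. fact N / (R_sum \<rho> / 2) ^ N * mweight \<rho> \<alpha>) ?L"
    using R by (intro L2_set_right_distrib) simp
  also have "\<dots> = L2_set (mprob \<rho>) ?L"
    by (rule L2_set_cong) (auto simp: mprob_def)
  also have "\<dots> \<le> sqrt (max_mprob \<rho> N)"
    unfolding L2_set_def
  proof (rule real_sqrt_le_mono)
    \<comment> \<open>One factor of each square is replaced by the maximum; the remaining factors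
      sum to 1.\<close>
    have "(\<Sum>\<alpha>\<in>?L. (mprob \<rho> \<alpha>)\<^sup>2) \<le> (\<Sum>\<alpha>\<in>?L. max_mprob \<rho> N * mprob \<rho> \<alpha>)"
      unfolding power2_eq_square
      using mprob_le_max[of \<rho>] by (intro sum_mono mult_right_mono mprob_nonneg \<rho>) auto
    also have "\<dots> = max_mprob \<rho> N" using R by (simp add: sum_mprob flip: sum_distrib_left)
    finally show "(\<Sum>\<alpha>\<in>?L. (mprob \<rho> \<alpha>)\<^sup>2) \<le> max_mprob \<rho> N" .
  qed
  finally show ?thesis .
qed

text \<open>Follows the computation of \<open>row_bound\<close>, but keeps the individual weight of
  \<open>\<alpha>\<close> instead of enlarging it to the sum over its level; the dependence on
  \<open>\<alpha>\<close> is what makes the rows vanish at infinity.\<close>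

lemma H_entry_row_le_mprob:
  assumes \<rho>: "\<rho> \<in> B_simplex" and R0: "0 < R_sum \<rho>" and G: "finite G"
  shows "(\<Sum>\<beta>\<in>G. \<bar>H_entry \<rho> \<alpha> \<beta>\<bar>) \<le> 2 * mprob \<rho> \<alpha>"
proof -
  let ?m = "mabs \<alpha>"
  obtain M where M: "mabs ` G \<subseteq> {..M}"
    using finite_nat_set_iff_bounded_le[of "mabs ` G"] G by auto
  have R: "R_sum \<rho> \<le> 1" using \<rho> by (auto simp: B_simplex_def R_sum_def)
  have w: "0 \<le> mweight \<rho> \<alpha>" by (rule mweight_nonneg[OF \<rho>])
  have "(\<Sum>\<beta>\<in>G. \<bar>H_entry \<rho> \<alpha> \<beta>\<bar>) = (\<Sum>n\<le>M. \<Sum>\<beta> | \<beta> \<in> G \<and> mabs \<beta> = n. \<bar>H_entry \<rho> \<alpha> \<beta>\<bar>)"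
    by (rule sum.group[symmetric, OF G _ M]) simp
  also have "\<dots> \<le> (\<Sum>n\<le>M. \<Sum>\<beta> | mabs \<beta> = n. \<bar>H_entry \<rho> \<alpha> \<beta>\<bar>)"
    by (intro sum_mono sum_mono2 finite_mabs) auto
  also have "\<dots> = (\<Sum>n\<le>M. fact (?m + n) * mweight \<rho> \<alpha> * ((R_sum \<rho> / 2) ^ n / fact n))"
    unfolding sum_mweight[symmetric] sum_distrib_left
    by (intro sum.cong refl) (simp add: abs_H_entry[OF \<rho>])
  also have "\<dots> \<le> (\<Sum>n\<le>M. fact (?m + n) * mweight \<rho> \<alpha> * ((1 / 2) ^ n / fact n))"
    using R R0 w by (intro sum_mono mult_left_mono divide_right_mono power_mono) auto
  also have "\<dots> = fact ?m * mweight \<rho> \<alpha> * (\<Sum>n\<le>M. real ((?m + n) choose n) / 2 ^ n)"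
    unfolding sum_distrib_left
    by (intro sum.cong refl) (simp add: binomial_fact power_one_over field_simps)
  also have "\<dots> \<le> fact ?m * mweight \<rho> \<alpha> * 2 ^ Suc ?m"
    by (intro mult_left_mono sum_choose_half) (simp add: w)
  \<comment> \<open>The power of 2 from the binomial series combines with the denominator of
    \<open>mprob\<close>, leaving \<open>R_sum \<rho> ^ ?m\<close>, which is at most 1.\<close>
  also have "\<dots> = 2 * mprob \<rho> \<alpha> * R_sum \<rho> ^ ?m"
    using R0 by (simp add: mprob_def power_divide field_simps)
  also have "\<dots> \<le> 2 * mprob \<rho> \<alpha> * 1"
    using R R0 mprob_nonneg[OF \<rho>] by (intro mult_left_mono power_le_one) auto
  finally show ?thesis by simp
qed

theorem mainTheorem5:
  fixes \<rho> :: "real ^ 'd"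
  assumes "\<rho> \<in> B_simplex"
    and "2 \<le> card {j. 0 < \<rho> $ j}"
  shows "compact_operator (D_op \<rho>) \<and> compact_operator (H_op \<rho>)"
proof
  note \<rho> = assms(1)
  obtain j k where jk: "0 < \<rho> $ j" "0 < \<rho> $ k" "j \<noteq> k"
    using assms(2) by (auto simp: card_le_Suc_iff numeral_2_eq_2)
  have "\<rho> $ j \<le> R_sum \<rho>"
    unfolding R_sum_def using \<rho> by (intro member_le_sum) (auto simp: B_simplex_def)
  hence R: "0 < R_sum \<rho>" using jk by simp
  have u: "max_mprob \<rho> \<longlonglongrightarrow> 0" by (rule max_mprob_tendsto_0[OF \<rho> jk R])
  \<comment> \<open>For a diagonal matrix the row sum is the diagonal entry itself, so it suffices
    that \<open>c_coef N \<rho>\<close> tends to 0.\<close>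
  show "compact_operator (D_op \<rho>)"
  proof (rule compact_operator_of_vanishing_rows[where C = 1 and r = "\<lambda>N. c_coef N \<rho>"
        and A = "\<lambda>i j. if i = j then complex_of_real (c_coef j \<rho>) else 0"])
    show "ell2_nth (D_op \<rho> (ell2_basis n)) i = (if i = n then complex_of_real (c_coef n \<rho>) else 0)"
      for i n by (simp add: D_op(2)[OF \<rho>] scaleC_ell2.rep_eq ell2_basis.rep_eq)
    show "(\<Sum>n\<in>G. cmod (if i = n then complex_of_real (c_coef n \<rho>) else 0)) \<le> c_coef i \<rho>"
      if "finite G" for i G
      using that c_coef_bounds[OF \<rho>] by (simp add: if_distrib cong: if_cong)
    show "(\<Sum>i\<in>F. cmod (if i = n then complex_of_real (c_coef n \<rho>) else 0)) \<le> 1"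
      if "finite F" for n F
      using that c_coef_bounds[OF \<rho>] by (simp add: if_distrib cong: if_cong)
    fix e :: real assume "0 < e"
    moreover have "(\<lambda>N. sqrt (max_mprob \<rho> N)) \<longlonglongrightarrow> 0" using tendsto_real_sqrt[OF u] by simp
    ultimately obtain N where N: "\<And>n. N \<le> n \<Longrightarrow> sqrt (max_mprob \<rho> n) < e"
      using order_tendstoD(2) by (fastforce simp: eventually_sequentially)
    have "{i. e < c_coef i \<rho>} \<subseteq> {..<N}"
    proof
      fix n assume "n \<in> {i. e < c_coef i \<rho>}"
      hence "\<not> sqrt (max_mprob \<rho> n) < e" using c_coef_le_sqrt_max_mprob[OF \<rho> R, of n] by simp
      thus "n \<in> {..<N}" using N[of n] by (metis lessThan_iff not_le)
    qed
    thus "finite {i. e < c_coef i \<rho>}" by (rule finite_subset) simp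
  qed (rule D_op(1)[OF \<rho>])
  show "compact_operator (H_op \<rho>)"
  proof (rule compact_operator_of_vanishing_rows[OF H_op[OF \<rho>], where C = 2
        and r = "\<lambda>\<alpha>. 2 * mprob \<rho> \<alpha>"])
    show "(\<Sum>\<beta>\<in>G. cmod (complex_of_real (H_entry \<rho> \<alpha> \<beta>))) \<le> 2 * mprob \<rho> \<alpha>" if "finite G" for \<alpha> G
      using H_entry_row_le_mprob[OF \<rho> R that] by simp
    \<comment> \<open>By symmetry of the entries, columns inherit the uniform bound of
      \<open>row_bound\<close>.\<close>
    show "(\<Sum>\<alpha>\<in>F. cmod (complex_of_real (H_entry \<rho> \<alpha> \<beta>))) \<le> 2" if "finite F" for \<beta> F
      using row_bound[OF \<rho> that, of \<beta>] by (simp add: H_entry_sym[of \<rho> _ \<beta>])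
    show "finite {\<alpha>. e < 2 * mprob \<rho> \<alpha>}" if "0 < e" for e
      using finite_mprob_large[OF u, of "e / 2"] that by (simp add: mult.commute divide_less_eq)
  qed
qed

end
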